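(* Let $u\in L^2(\Gamma)$ be the control component of the solution of the continuous optimal control problem $(P)$, and let $u_h\in L^2(\Gamma^h)$ be the control component of the solution of the discrete optimal control problem $(P_h)$ (both problems are defined in the context). Put $y=Su$ and $y_h=S_hu_h$. Then for all sufficiently small $h>0$ there holds $$ \alpha\,\big\|u_h^l-u\big\|_{L^2(\Gamma)}^2+\big\|y_h^l-y\big\|_{L^2(\Gamma)}^2\le\frac{1+c_{\mathrm{int}}h^2}{1-c_{\mathrm{int}}h^2}\left(\frac1\alpha\Big\|\big((\cdot)^l S_h^*(\cdot)_l-S^*\big)(y-z)\Big\|_{L^2(\Gamma)}^2+\Big\|\big((\cdot)^l S_h(\cdot)_l-S\big)u\Big\|_{L^2(\Gamma)}^2\right). $$
   Context: Surface. Let $n\in\{1,2\}$ and let $\Gamma\subset\mathbb R^{n+1}$ be a compact embedded hypersurface of class $C^2$ without boundary, with unit normal field $\nu$. Let $d$ be the signed distance function of $\Gamma$ (so $|d(x)|=\mathrm{dist}(x,\Gamma)$) with $\nabla d=\nu$ on $\Gamma$. There is a neighbourhood $\mathcal N$ of $\Gamma$ on which $d$ is $C^2$ and the projection $\pi:\mathcal N\to\Gamma$, $\pi(x)=x-d(x)\nabla d(x)$, is unique. $\nabla_\Gamma$ denotes the surface gradient. Discrete surfaces. $(\Gamma^h)_h$ is a fixed family of polyhedral surfaces $\Gamma^h=\bigcup_{i\in I_h}T_h^i$ (globally of class $C^{0,1}$) approximating $\Gamma$, consisting of triangles (line segments if $n=1$) $T_h^i$ with corners on $\Gamma$ and maximal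 diameter $h$; the angles of all triangles are bounded away from zero uniformly in $h$. It is assumed that $\pi(\Gamma^h)=\Gamma$; for small $h$, $\pi$ is injective on $\Gamma^h$. Lifts. For $v\in L^2(\Gamma^h)$ the lift $v^l$ on $\Gamma$ is $v^l(\pi(x))=v(x)$, $x\in\Gamma^h$; for $v\in L^2(\Gamma)$ the inverse lift $v_l$ on $\Gamma^h$ is $v_l(x)=v(\pi(x))$, $x\in\Gamma^h$. For small $h$ the operators $(\cdot)_l:L^2(\Gamma)\to L^2(\Gamma^h)$ and $(\cdot)^l:L^2(\Gamma^h)\to L^2(\Gamma)$ are mutually inverse linear homeomorphisms. Let $\frac{d\Gamma}{d\Gamma^h}$ be the Jacobian $|\det M|$ of $\pi|_{\Gamma^h}:\Gamma^h\to\Gamma$ (with $M$ the matrix of the derivative of $\pi|_{\Gamma^h}$ in orthonormal bases of the tangent spaces) and $\frac{d\Gamma^h}{d\Gamma}=|\det M^{-1}|$. The constant $c_{\mathrm{int}}>0$ is independent of $h$ and such that, for all sufficiently small $h$, $\sup\big|1-\frac{d\Gamma}{d\Gamma^h}\big|\le c_{\mathrm{int}}h^2$, $\sup\big|1-\frac{d\Gamma^h}{d\Gamma}\big|\le c_{\mathrm{int}}h^2$, and $$1-c_{\mathrm{int}}h^2\le\|(\cdot)_l\|^2_{\mathcal L(L^2(\Gamma),L^2(\Gamma^h))},\ \|(\cdot)^l\|^2_{\mathcal L(L^2(\Gamma^h),L^2(\Gamma))}\le1+c_{\mathrm{int}}h^2 .$$ The existence of such a constant is known. Solution operators. $S:L^2(\Gamma)\to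 L^2(\Gamma)$ maps $u$ to the unique $y\in H^1(\Gamma)$ with $\int_\Gamma\nabla_\Gamma y\cdot\nabla_\Gamma\varphi+y\varphi\,d\Gamma=\int_\Gamma u\varphi\,d\Gamma$ for all $\varphi\in H^1(\Gamma)$. Let $V_h=\{\varphi\in C^0(\Gamma^h):\varphi|_{T_h^i}\text{ is affine for all }i\in I_h\}\subset H^1(\Gamma^h)$. $S_h:L^2(\Gamma^h)\to L^2(\Gamma^h)$ maps $f$ to the unique $y_h\in V_h$ with $\int_{\Gamma^h}\nabla_{\Gamma^h}y_h\cdot\nabla_{\Gamma^h}\varphi+y_h\varphi\,d\Gamma^h=\int_{\Gamma^h}f\varphi\,d\Gamma^h$ for all $\varphi\in V_h$. $S^*$ and $S_h^*$ are the adjoints in $L^2(\Gamma)$ and $L^2(\Gamma^h)$. The expression $(\cdot)^lS_h(\cdot)_l$ denotes the composed operator $v\mapsto(S_hv_l)^l$ on $L^2(\Gamma)$, and similarly for $(\cdot)^lS_h^*(\cdot)_l$. Problems. Fix $\alpha>0$, $z\in L^2(\Gamma)$ and real numbers $a<b$. $(P)$: minimize $\frac12\|y-z\|^2_{L^2(\Gamma)}+\frac\alpha2\|u\|^2_{L^2(\Gamma)}$ over $u\in U_{ad}=\{v\in L^2(\Gamma):a\le v\le b\}$, $y\in H^1(\Gamma)$, subject to $y=Su$. $(P_h)$: minimize $\frac12\|y-z_l\|^2_{L^2(\Gamma^h)}+\frac\alpha2\|u\|^2_{L^2(\Gamma^h)}$ over $u\in U_{ad}^h=\{v\in L^2(\Gamma^h):a\le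 v\le b\}$, $y\in H^1(\Gamma^h)$, subject to $y=S_hu$. Both problems have unique solutions. *)

theory Defs
  imports "HOL-Analysis.Analysis" "Jordan_Normal_Form.Determinant"
begin

(* Both libraries claim this infix; below it always denotes the Euclidean inner product. *)
no_notation scalar_prod (infix "\<bullet>" 70)

section \<open>Surface measure and Lebesgue spaces\<close>

definition hausdorff_pre :: "nat \<Rightarrow> real \<Rightarrow> 'a::euclidean_space set \<Rightarrow> ennreal" where
  "hausdorff_pre n \<delta> A =
     (INF C \<in> {C :: nat \<Rightarrow> 'a set. (\<forall>i. bounded (C i) \<and> diameter (C i) \<le> \<delta>) \<and> A \<subseteq> (\<Union>i. C i)}.
        \<Sum>i. ennreal (unit_ball_vol (real n) * (diameter (C i) / 2) ^ n))"

definition hausdorff_outer :: "nat \<Rightarrow> 'a::euclidean_space set \<Rightarrow> ennreal" where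
  "hausdorff_outer n A = (SUP \<delta> \<in> {0<..}. hausdorff_pre n \<delta> A)"

text \<open>The surface measure is the \<open>n\<close>-dimensional Hausdorff measure (for \<open>n \<ge> 1\<close>), normalised to agree with
  Lebesgue measure on \<open>n\<close>-planes and restricted to the Borel subsets of \<open>\<Sigma>\<close>.  By Caratheodory's
  criterion \<^const>\<open>hausdorff_outer\<close> is countably additive on Borel sets, so that
  \<^const>\<open>measure_of\<close> does return it.\<close>

definition surface_measure :: "nat \<Rightarrow> 'a::euclidean_space set \<Rightarrow> 'a measure" where
  "surface_measure n \<Sigma> = restrict_space (measure_of UNIV (sets borel) (hausdorff_outer n)) \<Sigma>"

text \<open>Elements of \<open>L\<^sup>2\<close> are represented by Borel functions; all notions below are invariant under
  changes on null sets, and values outside the surface are irrelevant.\<close>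

definition L2 :: "'a measure \<Rightarrow> ('a \<Rightarrow> 'b::euclidean_space) set" where
  "L2 M = {f \<in> borel_measurable M. integrable M (\<lambda>x. (norm (f x))\<^sup>2)}"

definition L2_norm :: "'a measure \<Rightarrow> ('a \<Rightarrow> 'b::euclidean_space) \<Rightarrow> real" where
  "L2_norm M f = sqrt (\<integral>x. (norm (f x))\<^sup>2 \<partial>M)"

definition L2_inner :: "'a measure \<Rightarrow> ('a \<Rightarrow> real) \<Rightarrow> ('a \<Rightarrow> real) \<Rightarrow> real" where
  "L2_inner M f g = (\<integral>x. f x * g x \<partial>M)"

text \<open>The value \<open>\<infinity>\<close> covers the case that \<open>T\<close> does not map \<open>L\<^sup>2(M)\<close> boundedly into \<open>L\<^sup>2(N)\<close>.\<close>

definition L2_opnorm :: "'a measure \<Rightarrow> 'a measure \<Rightarrow> (('a \<Rightarrow> real) \<Rightarrow> 'a \<Rightarrow> real) \<Rightarrow> ereal" where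
  "L2_opnorm M N T =
     (SUP f \<in> {f \<in> L2 M. L2_norm M f \<le> 1}. if T f \<in> L2 N then ereal (L2_norm N (T f)) else \<infinity>)"

definition L2_adjoint ::
  "'a measure \<Rightarrow> (('a \<Rightarrow> real) \<Rightarrow> 'a \<Rightarrow> real) \<Rightarrow> (('a \<Rightarrow> real) \<Rightarrow> 'a \<Rightarrow> real) \<Rightarrow> bool" where
  "L2_adjoint M S S' \<longleftrightarrow> (\<forall>v \<in> L2 M. S' v \<in> L2 M) \<and>
     (\<forall>v \<in> L2 M. \<forall>w \<in> L2 M. L2_inner M (S v) w = L2_inner M v (S' w))"

section \<open>Hypersurfaces\<close>

definition gradient :: "('a::real_inner \<Rightarrow> real) \<Rightarrow> 'a \<Rightarrow> 'a" where
  "gradient f x = (THE g. GDERIV f x :> g)"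

definition C2_on :: "'a::euclidean_space set \<Rightarrow> ('a \<Rightarrow> real) \<Rightarrow> bool" where
  "C2_on U f \<longleftrightarrow> (\<exists>G. \<exists>H :: 'a \<Rightarrow> 'a \<Rightarrow>\<^sub>L 'a.
     (\<forall>x\<in>U. GDERIV f x :> G x \<and> (G has_derivative blinfun_apply (H x)) (at x)) \<and> continuous_on U H)"

definition C2_hypersurface :: "'a::euclidean_space set \<Rightarrow> bool" where
  "C2_hypersurface \<Gamma> \<longleftrightarrow> (\<forall>p\<in>\<Gamma>. \<exists>U F. open U \<and> p \<in> U \<and> C2_on U F \<and>
     (\<forall>x \<in> \<Gamma> \<inter> U. gradient F x \<noteq> 0) \<and> \<Gamma> \<inter> U = {x \<in> U. F x = 0})"

text \<open>Local Lipschitz graphs.\<close>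

definition Lipschitz_hypersurface :: "'a::euclidean_space set \<Rightarrow> bool" where
  "Lipschitz_hypersurface \<Sigma> \<longleftrightarrow> (\<forall>p\<in>\<Sigma>. \<exists>U e g L. open U \<and> p \<in> U \<and> norm e = 1 \<and>
     L-lipschitz_on {w. w \<bullet> e = 0} g \<and>
     \<Sigma> \<inter> U = {x \<in> U. x \<bullet> e = g (x - (x \<bullet> e) *\<^sub>R e)})"

text \<open>The span of the limiting secant directions (Bouligand cone).  For a \<open>C\<^sup>1\<close> hypersurface, or for a
  simplex at any of its points, this is the usual tangent space; on a polyhedral surface it is the
  usual one away from the edges, which are null sets.\<close>

definition tangent_space :: "'a::euclidean_space set \<Rightarrow> 'a \<Rightarrow> 'a set" where
  "tangent_space \<Sigma> x = span {v. \<exists>X t. (\<forall>k. X k \<in> \<Sigma> \<and> t k > 0) \<and> X \<longlonglongrightarrow> x \<and>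
     (\<lambda>k. t k *\<^sub>R (X k - x)) \<longlonglongrightarrow> v}"

definition unit_normal_field :: "'a::euclidean_space set \<Rightarrow> ('a \<Rightarrow> 'a) \<Rightarrow> bool" where
  "unit_normal_field \<Gamma> \<nu> \<longleftrightarrow> continuous_on \<Gamma> \<nu> \<and>
     (\<forall>x\<in>\<Gamma>. norm (\<nu> x) = 1 \<and> (\<forall>v \<in> tangent_space \<Gamma> x. \<nu> x \<bullet> v = 0))"

text \<open>Continuity makes the sign constant on each component of the complement of \<open>\<Gamma>\<close>, so that it is
  determined by \<open>\<nu>\<close>.\<close>

definition signed_distance :: "'a::euclidean_space set \<Rightarrow> ('a \<Rightarrow> 'a) \<Rightarrow> ('a \<Rightarrow> real) \<Rightarrow> bool" where
  "signed_distance \<Gamma> \<nu> d \<longleftrightarrow> continuous_on UNIV d \<and> (\<forall>x. \<bar>d x\<bar> = infdist x \<Gamma>) \<and>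
     (\<forall>x\<in>\<Gamma>. GDERIV d x :> \<nu> x)"

definition projection :: "('a::euclidean_space \<Rightarrow> real) \<Rightarrow> 'a \<Rightarrow> 'a" where
  "projection d x = x - d x *\<^sub>R gradient d x"

definition projection_nbhd :: "'a::euclidean_space set \<Rightarrow> ('a \<Rightarrow> real) \<Rightarrow> 'a set \<Rightarrow> bool" where
  "projection_nbhd \<Gamma> d N \<longleftrightarrow> open N \<and> \<Gamma> \<subseteq> N \<and> C2_on N d \<and>
     (\<forall>x\<in>N. projection d x \<in> \<Gamma> \<and> dist x (projection d x) = infdist x \<Gamma> \<and>
       (\<forall>p\<in>\<Gamma>. dist x p = infdist x \<Gamma> \<longrightarrow> p = projection d x))"

section \<open>Surface gradients and Sobolev spaces\<close>

text \<open>\<open>g\<close> is the classical surface gradient of \<open>\<phi>\<close> (a function given on \<open>\<Sigma>\<close> only) at \<open>x\<close>.\<close>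

definition has_surface_gradient :: "('a::euclidean_space \<Rightarrow> real) \<Rightarrow> 'a \<Rightarrow> 'a set \<Rightarrow> 'a \<Rightarrow> bool" where
  "has_surface_gradient \<phi> g \<Sigma> x \<longleftrightarrow>
     g \<in> tangent_space \<Sigma> x \<and> (\<phi> has_derivative (\<lambda>v. g \<bullet> v)) (at x within \<Sigma>)"

text \<open>Continuous functions on \<open>\<Union>\<P>\<close> that are \<open>C\<^sup>1\<close> on each piece \<open>P \<in> \<P>\<close>.  With \<open>\<P> = {\<Gamma>}\<close> this is
  \<open>C\<^sup>1(\<Gamma>)\<close>; for a polyhedral surface the pieces are the closed triangles.\<close>

definition piecewise_C1 :: "'a::euclidean_space set set \<Rightarrow> ('a \<Rightarrow> real) \<Rightarrow> bool" where
  "piecewise_C1 \<P> \<phi> \<longleftrightarrow> continuous_on (\<Union>\<P>) \<phi> \<and>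
     (\<forall>P\<in>\<P>. \<exists>G. continuous_on P G \<and> (\<forall>x\<in>P. has_surface_gradient \<phi> (G x) P x))"

text \<open>Pairs of a function and its almost everywhere classical surface gradient.\<close>

definition classical_pairs :: "nat \<Rightarrow> 'a::euclidean_space set \<Rightarrow> (('a \<Rightarrow> real) \<times> ('a \<Rightarrow> 'a)) set" where
  "classical_pairs n \<Sigma> = {(\<phi>, G). \<phi> \<in> L2 (surface_measure n \<Sigma>) \<and> G \<in> L2 (surface_measure n \<Sigma>) \<and>
     (AE x in surface_measure n \<Sigma>. has_surface_gradient \<phi> (G x) \<Sigma> x)}"

text \<open>\<open>H\<^sup>1(\<Union>\<P>)\<close> as the completion of the (piecewise) \<open>C\<^sup>1\<close> functions in the \<open>H\<^sup>1\<close> norm, realised in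
  \<open>L\<^sup>2\<close>: the set of all pairs of a function and its weak surface gradient.\<close>

definition H1_pairs :: "nat \<Rightarrow> 'a::euclidean_space set set \<Rightarrow> (('a \<Rightarrow> real) \<times> ('a \<Rightarrow> 'a)) set" where
  "H1_pairs n \<P> = (let M = surface_measure n (\<Union>\<P>) in
     {(y, g). y \<in> L2 M \<and> g \<in> L2 M \<and>
        (\<exists>\<phi> G. (\<forall>k. piecewise_C1 \<P> (\<phi> k) \<and> (\<phi> k, G k) \<in> classical_pairs n (\<Union>\<P>)) \<and>
           (\<lambda>k. L2_norm M (\<lambda>x. \<phi> k x - y x)) \<longlonglongrightarrow> 0 \<and>
           (\<lambda>k. L2_norm M (\<lambda>x. G k x - g x)) \<longlonglongrightarrow> 0)})"

definition H1 :: "nat \<Rightarrow> 'a::euclidean_space set set \<Rightarrow> ('a \<Rightarrow> real) set" where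
  "H1 n \<P> = fst ` H1_pairs n \<P>"

definition affine_on :: "'a::euclidean_space set \<Rightarrow> ('a \<Rightarrow> real) \<Rightarrow> bool" where
  "affine_on T \<phi> \<longleftrightarrow> (\<exists>c g. \<forall>x\<in>T. \<phi> x = c + g \<bullet> x)"

definition FE_space :: "'a::euclidean_space set set \<Rightarrow> ('a \<Rightarrow> real) set" where
  "FE_space \<T> = {\<phi>. continuous_on (\<Union>\<T>) \<phi> \<and> (\<forall>T\<in>\<T>. affine_on T \<phi>)}"

definition FE_pairs :: "nat \<Rightarrow> 'a::euclidean_space set set \<Rightarrow> (('a \<Rightarrow> real) \<times> ('a \<Rightarrow> 'a)) set" where
  "FE_pairs n \<T> = {(\<phi>, G) \<in> classical_pairs n (\<Union>\<T>). \<phi> \<in> FE_space \<T>}"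

section \<open>Solution operators and control problems\<close>

text \<open>Here \<open>V\<close> consists of pairs \<open>(\<phi>, \<nabla>\<phi>)\<close>, i.e. it is \<^const>\<open>H1_pairs\<close> or \<^const>\<open>FE_pairs\<close>.
  The solution is unique up to null sets, as testing with the difference of two solutions shows.\<close>

definition variational_solution ::
  "'a::euclidean_space measure \<Rightarrow> (('a \<Rightarrow> real) \<times> ('a \<Rightarrow> 'a)) set \<Rightarrow> ('a \<Rightarrow> real) \<Rightarrow> ('a \<Rightarrow> real) \<Rightarrow> bool"
  where
  "variational_solution M V u y \<longleftrightarrow> (\<exists>g. (y, g) \<in> V \<and>
     (\<forall>(\<phi>, \<gamma>) \<in> V. (\<integral>x. g x \<bullet> \<gamma> x + y x * \<phi> x \<partial>M) = (\<integral>x. u x * \<phi> x \<partial>M)))"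

definition solution_operator ::
  "'a::euclidean_space measure \<Rightarrow> (('a \<Rightarrow> real) \<times> ('a \<Rightarrow> 'a)) set \<Rightarrow> (('a \<Rightarrow> real) \<Rightarrow> 'a \<Rightarrow> real) \<Rightarrow> bool"
  where
  "solution_operator M V S \<longleftrightarrow> (\<forall>u \<in> L2 M. variational_solution M V u (S u))"

definition admissible_controls :: "'a measure \<Rightarrow> real \<Rightarrow> real \<Rightarrow> ('a \<Rightarrow> real) set" where
  "admissible_controls M a b = {v \<in> L2 M. AE x in M. a \<le> v x \<and> v x \<le> b}"

definition feasible_pairs ::
  "'a measure \<Rightarrow> ('a \<Rightarrow> real) set \<Rightarrow> (('a \<Rightarrow> real) \<Rightarrow> 'a \<Rightarrow> real) \<Rightarrow> real \<Rightarrow> real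
     \<Rightarrow> (('a \<Rightarrow> real) \<times> ('a \<Rightarrow> real)) set" where
  "feasible_pairs M Y S a b =
     {(u, y). u \<in> admissible_controls M a b \<and> y \<in> Y \<and> (AE x in M. y x = S u x)}"

definition cost :: "'a measure \<Rightarrow> real \<Rightarrow> ('a \<Rightarrow> real) \<Rightarrow> ('a \<Rightarrow> real) \<Rightarrow> ('a \<Rightarrow> real) \<Rightarrow> real" where
  "cost M \<alpha> z u y = 1 / 2 * (L2_norm M (\<lambda>x. y x - z x))\<^sup>2 + \<alpha> / 2 * (L2_norm M u)\<^sup>2"

definition solves_control_problem ::
  "'a measure \<Rightarrow> ('a \<Rightarrow> real) set \<Rightarrow> (('a \<Rightarrow> real) \<Rightarrow> 'a \<Rightarrow> real) \<Rightarrow> real \<Rightarrow> ('a \<Rightarrow> real) \<Rightarrow> real \<Rightarrow> real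
     \<Rightarrow> ('a \<Rightarrow> real) \<Rightarrow> ('a \<Rightarrow> real) \<Rightarrow> bool" where
  "solves_control_problem M Y S \<alpha> z a b u y \<longleftrightarrow> (u, y) \<in> feasible_pairs M Y S a b \<and>
     (\<forall>(v, w) \<in> feasible_pairs M Y S a b. cost M \<alpha> z u y \<le> cost M \<alpha> z v w)"

section \<open>Discrete surfaces and lifts\<close>

definition corner_angle :: "'a::euclidean_space \<Rightarrow> 'a \<Rightarrow> 'a \<Rightarrow> real" where
  "corner_angle q p r = arccos (((q - p) \<bullet> (r - p)) / (norm (q - p) * norm (r - p)))"

text \<open>\<open>\<T>\<close> is the set of triangles (segments for \<open>n = 1\<close>) of one discrete surface \<open>\<Union>\<T>\<close> of mesh size \<open>h\<close>
  inscribed in \<open>\<Gamma>\<close>; for segments the angle condition is void.\<close>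

definition inscribed_polyhedral_surface ::
  "nat \<Rightarrow> 'a::euclidean_space set \<Rightarrow> real \<Rightarrow> real \<Rightarrow> 'a set set \<Rightarrow> bool" where
  "inscribed_polyhedral_surface n \<Gamma> \<theta> h \<T> \<longleftrightarrow>
     finite \<T> \<and> \<T> \<noteq> {} \<and>
     (\<forall>T\<in>\<T>. int n simplex T) \<and>
     (\<forall>T\<in>\<T>. \<forall>T'\<in>\<T>. T \<noteq> T' \<longrightarrow> rel_interior T \<inter> rel_interior T' = {}) \<and>
     Lipschitz_hypersurface (\<Union>\<T>) \<and>
     (\<forall>T\<in>\<T>. {p. p extreme_point_of T} \<subseteq> \<Gamma>) \<and>
     Max (diameter ` \<T>) = h \<and>
     (\<forall>T\<in>\<T>. \<forall>p q r. p extreme_point_of T \<and> q extreme_point_of T \<and> r extreme_point_of T \<and>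
        p \<noteq> q \<and> p \<noteq> r \<and> q \<noteq> r \<longrightarrow> \<theta> \<le> corner_angle q p r)"

text \<open>\<open>H\<close> is the set of mesh sizes occurring in the family.\<close>

definition discrete_surfaces ::
  "nat \<Rightarrow> 'a::euclidean_space set \<Rightarrow> ('a \<Rightarrow> real) \<Rightarrow> 'a set \<Rightarrow> real set \<Rightarrow> (real \<Rightarrow> 'a set set) \<Rightarrow> bool" where
  "discrete_surfaces n \<Gamma> d N H \<T> \<longleftrightarrow> H \<subseteq> {0<..} \<and>
     (\<exists>\<theta>>0. \<forall>h\<in>H. inscribed_polyhedral_surface n \<Gamma> \<theta> h (\<T> h)) \<and>
     (\<forall>h\<in>H. \<Union>(\<T> h) \<subseteq> N \<and> projection d ` \<Union>(\<T> h) = \<Gamma>) \<and>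
     (\<forall>\<^sub>F h in at 0 within H. inj_on (projection d) (\<Union>(\<T> h)))"

definition lift :: "('a \<Rightarrow> 'a) \<Rightarrow> 'a set \<Rightarrow> ('a \<Rightarrow> real) \<Rightarrow> 'a \<Rightarrow> real" where
  "lift p \<Sigma> v y = v (inv_into \<Sigma> p y)"

definition inverse_lift :: "('a \<Rightarrow> 'a) \<Rightarrow> ('a \<Rightarrow> real) \<Rightarrow> 'a \<Rightarrow> real" where
  "inverse_lift p v x = v (p x)"

definition orthonormal_basis :: "nat \<Rightarrow> 'a::euclidean_space set \<Rightarrow> (nat \<Rightarrow> 'a) \<Rightarrow> bool" where
  "orthonormal_basis n V b \<longleftrightarrow>
     (\<forall>i<n. \<forall>j<n. b i \<bullet> b j = (if i = j then 1 else 0)) \<and> span (b ` {..<n}) = V"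

text \<open>Jacobian of \<open>f\<close> restricted to the \<open>n\<close>-dimensional surface \<open>\<Sigma>\<close>, with values in \<open>\<Sigma>'\<close>; the choice of
  the bases only affects the sign of the determinant.\<close>

definition surface_jacobian ::
  "nat \<Rightarrow> ('a::euclidean_space \<Rightarrow> 'a) \<Rightarrow> 'a set \<Rightarrow> 'a set \<Rightarrow> 'a \<Rightarrow> real" where
  "surface_jacobian n f \<Sigma> \<Sigma>' x =
     (let b = SOME b. orthonormal_basis n (tangent_space \<Sigma> x) b;
          c = SOME c. orthonormal_basis n (tangent_space \<Sigma>' (f x)) c
      in \<bar>Determinant.det (Matrix.mat n n (\<lambda>(i, j). c i \<bullet> frechet_derivative f (at x) (b j)))\<bar>)"

text \<open>The second Jacobian \<open>\<bar>det M\<^sup>-\<^sup>1\<bar>\<close> is written as \<open>1 / \<bar>det M\<bar>\<close>.  Both are defined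
  away from the edges.\<close>

definition interpolation_constant ::
  "nat \<Rightarrow> 'a::euclidean_space set \<Rightarrow> ('a \<Rightarrow> real) \<Rightarrow> real set \<Rightarrow> (real \<Rightarrow> 'a set set) \<Rightarrow> real \<Rightarrow> bool" where
  "interpolation_constant n \<Gamma> d H \<T> c \<longleftrightarrow> c > 0 \<and>
     (\<forall>\<^sub>F h in at 0 within H.
        let \<Gamma>h = \<Union>(\<T> h); M = surface_measure n \<Gamma>; Mh = surface_measure n \<Gamma>h; p = projection d;
            J = surface_jacobian n p \<Gamma>h \<Gamma>;
            inverse_lift_norm = L2_opnorm M Mh (inverse_lift p);
            lift_norm = L2_opnorm Mh M (lift p \<Gamma>h)
        in (\<forall>T \<in> \<T> h. \<forall>x \<in> rel_interior T. \<bar>1 - J x\<bar> \<le> c * h\<^sup>2 \<and> \<bar>1 - 1 / J x\<bar> \<le> c * h\<^sup>2) \<and>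
           ereal (1 - c * h\<^sup>2) \<le> inverse_lift_norm\<^sup>2 \<and> inverse_lift_norm\<^sup>2 \<le> ereal (1 + c * h\<^sup>2) \<and>
           ereal (1 - c * h\<^sup>2) \<le> lift_norm\<^sup>2 \<and> lift_norm\<^sup>2 \<le> ereal (1 + c * h\<^sup>2))"

end

theory Submission
  imports Defs
begin

text \<open>All comparisons of \<open>u\<close> and \<open>u\<^sub>h\<close> are made on the discrete surface, in \<open>L\<^sup>2(\<Gamma>\<^sup>h)\<close>.  The
  optimality condition of the continuous problem, \<open>\<langle>\<alpha>u + p, v - u\<rangle> \<ge> 0\<close> for all admissible \<open>v\<close> with
  \<open>p = S\<^sup>*(y - z)\<close>, involves the inner product of the wrong surface.  Because the constraints are
  pointwise, however, it is equivalent to \<open>(\<alpha>u + p)(c - u) \<ge> 0\<close> almost everywhere for all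
  \<open>c \<in> [a, b]\<close> (lemma \<open>variational_inequality_pointwise\<close>).  In this form it can be pulled back along
  the projection \<open>\<pi>\<close>, under which preimages of null sets are null sets
  (lemma \<open>AE_inverse_lift\<close>), and integrated over \<open>\<Gamma>\<^sup>h\<close> with \<open>c = u\<^sub>h\<close>.  No Jacobian appears, so the sign structure is preserved exactly.

  Adding the optimality condition of the discrete problem, tested with \<open>u\<^sub>l\<close>, gives the estimate of
  the theorem with all norms taken on \<open>\<Gamma>\<^sup>h\<close> and with constant \<open>1\<close> (lemma
  \<open>control_error_estimate\<close>): the monotonicity of \<open>S\<^sub>h\<^sup>*S\<^sub>h\<close> produces the state error on the left, and
  Young's inequality does the rest.

  Carrying the left side to \<open>\<Gamma>\<close> by the lift and the right side by the inverse lift costs one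
  factor \<open>1 + c h\<^sup>2\<close> each, where \<open>c = c\<^sub>i\<^sub>n\<^sub>t\<close>.  Their product is at most
  \<open>(1 + c h\<^sup>2) / (1 - c h\<^sup>2)\<close> since \<open>(1 + c h\<^sup>2)(1 - c h\<^sup>2) \<le> 1\<close>.  The geometry of the surfaces thus
  enters only through the operator norms of the two lifts, the bijectivity of \<open>\<pi>\<close>, and the fact that
  finite element functions lie in \<open>H\<^sup>1(\<Gamma>\<^sup>h)\<close>, so that every discrete control has a feasible
  state.\<close>

section \<open>Square-integrable functions\<close>

lemma L2_iff:
  fixes f :: "'a \<Rightarrow> real"
  shows "f \<in> L2 M \<longleftrightarrow> f \<in> borel_measurable M \<and> integrable M (\<lambda>x. (f x)\<^sup>2)"
  by (simp add: L2_def)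

lemma L2_measurable [measurable_dest]: "f \<in> L2 M \<Longrightarrow> f \<in> borel_measurable M"
  by (simp add: L2_def)

lemma L2_power2_integrable:
  fixes f :: "'a \<Rightarrow> real"
  shows "f \<in> L2 M \<Longrightarrow> integrable M (\<lambda>x. (f x)\<^sup>2)"
  by (simp add: L2_iff)

lemma L2_mult_integrable:
  fixes f g :: "'a \<Rightarrow> real"
  assumes f: "f \<in> L2 M" and g: "g \<in> L2 M"
  shows "integrable M (\<lambda>x. f x * g x)"
proof (rule Bochner_Integration.integrable_bound)
  show "integrable M (\<lambda>x. (f x)\<^sup>2 + (g x)\<^sup>2)"
    using f g by (simp add: L2_power2_integrable)
  show "(\<lambda>x. f x * g x) \<in> borel_measurable M"
    using f g by (simp add: L2_measurable)
  have "\<bar>s * t\<bar> \<le> s\<^sup>2 + t\<^sup>2" for s t :: real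
  proof -
    have "0 \<le> \<bar>s\<bar> * \<bar>t\<bar>" by simp
    with zero_le_power2[of "\<bar>s\<bar> - \<bar>t\<bar>"] show ?thesis
      unfolding abs_mult power2_diff power2_abs by linarith
  qed
  then show "AE x in M. norm (f x * g x) \<le> norm ((f x)\<^sup>2 + (g x)\<^sup>2)"
    by simp
qed

lemma L2_cmult [simp]:
  fixes f :: "'a \<Rightarrow> real"
  assumes "f \<in> L2 M" shows "(\<lambda>x. c * f x) \<in> L2 M"
  unfolding L2_iff
proof
  show "(\<lambda>x. c * f x) \<in> borel_measurable M" using assms by (simp add: L2_measurable)
qed (use L2_power2_integrable[OF assms] in \<open>simp add: power_mult_distrib\<close>)

lemma L2_add [simp]:
  fixes f g :: "'a \<Rightarrow> real"
  assumes "f \<in> L2 M" "g \<in> L2 M" shows "(\<lambda>x. f x + g x) \<in> L2 M"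
  unfolding L2_iff
proof
  show "(\<lambda>x. f x + g x) \<in> borel_measurable M" using assms by (simp add: L2_measurable)
qed (use assms L2_mult_integrable[OF assms] in \<open>simp add: L2_power2_integrable power2_sum mult.assoc\<close>)

lemma L2_diff [simp]:
  fixes f g :: "'a \<Rightarrow> real"
  assumes "f \<in> L2 M" "g \<in> L2 M" shows "(\<lambda>x. f x - g x) \<in> L2 M"
  using L2_add[OF assms(1) L2_cmult[OF assms(2), of "-1"]] by simp

lemma L2_dominated:
  fixes f g :: "'a \<Rightarrow> real"
  assumes "g \<in> L2 M" "f \<in> borel_measurable M" "AE x in M. \<bar>f x\<bar> \<le> \<bar>g x\<bar>"
  shows "f \<in> L2 M"
proof -
  have "integrable M (\<lambda>x. (f x)\<^sup>2)"
  proof (rule Bochner_Integration.integrable_bound[OF L2_power2_integrable[OF assms(1)]])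
    show "AE x in M. norm ((f x)\<^sup>2) \<le> norm ((g x)\<^sup>2)"
      using assms(3) by eventually_elim (simp add: abs_le_square_iff)
  qed (use assms(2) in simp)
  with assms(2) show ?thesis by (simp add: L2_iff)
qed

lemma L2_cong:
  fixes f g :: "'a \<Rightarrow> real"
  assumes "\<And>x. x \<in> space M \<Longrightarrow> f x = g x"
  shows "f \<in> L2 M \<longleftrightarrow> g \<in> L2 M"
  unfolding L2_iff
  by (intro conj_cong measurable_cong Bochner_Integration.integrable_cong) (simp_all add: assms)

lemma L2_norm_cong:
  fixes f g :: "'a \<Rightarrow> real"
  assumes "\<And>x. x \<in> space M \<Longrightarrow> f x = g x"
  shows "L2_norm M f = L2_norm M g"
  unfolding L2_norm_def
  by (intro arg_cong[where f = sqrt] Bochner_Integration.integral_cong) (simp_all add: assms)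

lemma L2_norm_power2: "(L2_norm M f)\<^sup>2 = L2_inner M f f"
  by (simp add: L2_norm_def L2_inner_def power2_eq_square integral_nonneg_AE)

lemma L2_norm_nonneg: "0 \<le> L2_norm M f"
  by (simp add: L2_norm_def integral_nonneg_AE)

lemma L2_inner_self_nonneg: "0 \<le> L2_inner M f f"
  by (simp add: L2_inner_def integral_nonneg_AE)

lemma L2_inner_commute: "L2_inner M f g = L2_inner M g f"
  by (simp add: L2_inner_def mult.commute)

lemma L2_inner_bilinear:
  assumes "f \<in> L2 M" "g \<in> L2 M" "k \<in> L2 M"
  shows "L2_inner M (\<lambda>x. f x + g x) k = L2_inner M f k + L2_inner M g k"
    and "L2_inner M (\<lambda>x. f x - g x) k = L2_inner M f k - L2_inner M g k"
    and "L2_inner M (\<lambda>x. c * f x) k = c * L2_inner M f k"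
    and "L2_inner M k (\<lambda>x. f x + g x) = L2_inner M k f + L2_inner M k g"
    and "L2_inner M k (\<lambda>x. f x - g x) = L2_inner M k f - L2_inner M k g"
    and "L2_inner M k (\<lambda>x. c * f x) = c * L2_inner M k f"
  using assms
  by (simp_all add: L2_inner_def algebra_simps L2_mult_integrable mult.left_commute[of _ c])

lemma L2_norm_cmult: "(L2_norm M (\<lambda>x. c * f x))\<^sup>2 = c\<^sup>2 * (L2_norm M f)\<^sup>2" for f :: "'a \<Rightarrow> real"
  by (simp add: L2_norm_def integral_nonneg_AE power_mult_distrib)

lemma L2_norm_minus_commute:
  "L2_norm M (\<lambda>x. f x - g x) = L2_norm M (\<lambda>x. g x - f x)" for f g :: "'a \<Rightarrow> real"
  by (simp add: L2_norm_def power2_commute)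

lemma L2_Young:
  assumes f: "f \<in> L2 M" and g: "g \<in> L2 M" and c: "c > 0"
  shows "2 * L2_inner M f g \<le> c * L2_inner M f f + 1 / c * L2_inner M g g"
proof -
  have "0 \<le> L2_inner M (\<lambda>x. c * f x - g x) (\<lambda>x. c * f x - g x)"
    by (rule L2_inner_self_nonneg)
  also have "\<dots> = c * (c * L2_inner M f f + 1 / c * L2_inner M g g - 2 * L2_inner M f g)"
    using f g c by (simp add: L2_inner_bilinear L2_inner_commute[of M g f] field_simps)
  finally show ?thesis
    using c by (simp add: zero_le_mult_iff)
qed

lemma L2_inner_self_eq_0:
  assumes "f \<in> L2 M" "L2_inner M f f = 0"
  shows "AE x in M. f x = 0"
proof -
  have "AE x in M. f x * f x = 0"
    using assms integral_nonneg_eq_0_iff_AE[OF L2_mult_integrable[OF assms(1,1)]]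
    by (simp add: L2_inner_def)
  then show ?thesis by simp
qed

section \<open>Operators on square-integrable functions\<close>

text \<open>The supremum only sees the unit ball, so the estimate is obtained by scaling.  A function of
  norm \<open>0\<close> is scaled by every factor \<open>t > 0\<close>, which forces its image to have norm \<open>0\<close>.\<close>

lemma L2_opnorm_bound:
  assumes bound: "(L2_opnorm M N T)\<^sup>2 \<le> ereal C"
    and T: "\<And>c f. T (\<lambda>x. c * f x) = (\<lambda>x. c * T f x)"
    and f: "f \<in> L2 M"
  shows "T f \<in> L2 N" and "(L2_norm N (T f))\<^sup>2 \<le> C * (L2_norm M f)\<^sup>2"
proof -
  have ball: "T g \<in> L2 N \<and> (L2_norm N (T g))\<^sup>2 \<le> C" if g: "g \<in> L2 M" "L2_norm M g \<le> 1" for g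
  proof -
    define s where "s = (if T g \<in> L2 N then ereal (L2_norm N (T g)) else \<infinity>)"
    have s0: "0 \<le> s" by (simp add: s_def L2_norm_nonneg)
    have "s \<le> L2_opnorm M N T"
      unfolding L2_opnorm_def s_def by (rule SUP_upper) (use g in simp)
    then have "s\<^sup>2 \<le> (L2_opnorm M N T)\<^sup>2"
      using s0 by (simp add: power2_eq_square ereal_mult_mono)
    also note bound
    finally have le: "s\<^sup>2 \<le> ereal C" .
    then have "T g \<in> L2 N"
      by (auto simp: s_def power2_eq_square split: if_splits)
    with le show ?thesis by (simp add: s_def)
  qed
  define m where "m = L2_norm M f"
  have scaled: "T f \<in> L2 N \<and> t\<^sup>2 * (L2_norm N (T f))\<^sup>2 \<le> C" if t: "t > 0" "t * m \<le> 1" for t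
  proof -
    have "L2_norm M (\<lambda>x. t * f x) = t * m"
      using L2_norm_cmult[of M t f] t(1) L2_norm_nonneg
      by (simp add: m_def power_mult_distrib[symmetric] power2_eq_iff_nonneg L2_norm_nonneg)
    with ball[of "\<lambda>x. t * f x"] f t
    have *: "(\<lambda>x. t * T f x) \<in> L2 N \<and> t\<^sup>2 * (L2_norm N (T f))\<^sup>2 \<le> C"
      by (simp add: T L2_norm_cmult)
    have "(\<lambda>x. 1 / t * (t * T f x)) \<in> L2 N" by (rule L2_cmult[OF conjunct1[OF *]])
    moreover have "(\<lambda>x. 1 / t * (t * T f x)) = T f" using t(1) by simp
    ultimately show ?thesis using * by simp
  qed
  have m0: "0 \<le> m" by (simp add: m_def L2_norm_nonneg)
  have "1 / (1 + m) > 0" "1 / (1 + m) * m \<le> 1" using m0 by (simp_all add: field_simps)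
  from scaled[OF this] show "T f \<in> L2 N" ..
  show "(L2_norm N (T f))\<^sup>2 \<le> C * (L2_norm M f)\<^sup>2"
  proof (cases "m = 0")
    case False
    with m0 have "m > 0" by simp
    with scaled[of "1 / m"] show ?thesis
      by (simp add: m_def[symmetric] power_divide field_simps)
  next
    case True
    define k where "k = (L2_norm N (T f))\<^sup>2"
    have k: "t\<^sup>2 * k \<le> C" if "t > 0" for t using scaled[of t] that True by (simp add: k_def)
    have C0: "0 \<le> C" using k[of 1] by (simp add: k_def) (metis order_trans zero_le_power2)
    have "k \<le> 0"
    proof (rule ccontr)
      assume "\<not> k \<le> 0"
      then have "k > 0" by simp
      with k[of "sqrt ((C + 1) / k)"] C0 show False by simp
    qed
    with True show ?thesis by (simp add: k_def m_def[symmetric])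
  qed
qed

text \<open>A bounded composition operator cannot create mass out of null sets: it sends the indicator of
  a null set to a function of norm \<open>0\<close>.\<close>

lemma AE_inverse_lift:
  assumes mem: "\<And>f. f \<in> L2 M \<Longrightarrow> inverse_lift p f \<in> L2 N"
    and bound: "\<And>f. f \<in> L2 M \<Longrightarrow> (L2_norm N (inverse_lift p f))\<^sup>2 \<le> C * (L2_norm M f)\<^sup>2"
    and maps: "\<And>x. x \<in> space N \<Longrightarrow> p x \<in> space M"
    and ae: "AE x in M. P x"
  shows "AE x in N. P (p x)"
proof -
  from ae obtain A where A: "{x \<in> space M. \<not> P x} \<subseteq> A" "emeasure M A = 0" "A \<in> sets M"
    by (rule AE_E)
  define f :: "'a \<Rightarrow> real" where "f = indicator A"
  have f: "f \<in> L2 M"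
    using A by (simp add: L2_iff f_def power2_eq_square flip: indicator_inter_arith)
  have "L2_norm M f = 0"
    using A by (simp add: L2_norm_def f_def power2_eq_square measure_def flip: indicator_inter_arith)
  with bound[OF f] have "L2_inner N (inverse_lift p f) (inverse_lift p f) = 0"
    by (simp add: L2_norm_power2[symmetric])
  from L2_inner_self_eq_0[OF mem[OF f] this]
  have "AE x in N. p x \<notin> A"
    by eventually_elim (simp add: inverse_lift_def f_def indicator_eq_0_iff)
  then show ?thesis
    using AE_space by eventually_elim (use A maps in blast)
qed

text \<open>An operator possessing an adjoint is linear as an operator between classes of functions that
  agree almost everywhere: the defect is orthogonal to all of \<open>L\<^sup>2\<close>, hence to itself.\<close>

lemma L2_adjoint_linear:
  assumes S: "\<And>v. v \<in> L2 M \<Longrightarrow> S v \<in> L2 M" and adj: "L2_adjoint M S S'"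
    and f: "f \<in> L2 M" and g: "g \<in> L2 M"
  shows "AE x in M. S (\<lambda>x. f x + t * g x) x = S f x + t * S g x"
proof -
  define k where "k = (\<lambda>x. S (\<lambda>x. f x + t * g x) x - (S f x + t * S g x))"
  have mem: "S f \<in> L2 M" "S g \<in> L2 M" "S (\<lambda>x. f x + t * g x) \<in> L2 M"
    using f g by (simp_all add: S)
  have k: "k \<in> L2 M" using mem by (simp add: k_def)
  have a: "S' w \<in> L2 M" "L2_inner M (S v) w = L2_inner M v (S' w)" if "v \<in> L2 M" "w \<in> L2 M" for v w
    using adj that by (auto simp: L2_adjoint_def)
  have "L2_inner M k w = 0" if w: "w \<in> L2 M" for w
  proof -
    have "L2_inner M k w = L2_inner M (S (\<lambda>x. f x + t * g x)) w
        - (L2_inner M (S f) w + t * L2_inner M (S g) w)"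
      using mem w by (simp add: k_def L2_inner_bilinear)
    also have "\<dots> = 0"
      using f g w a(1)[OF f w] by (simp add: a(2) L2_inner_bilinear)
    finally show ?thesis .
  qed
  from L2_inner_self_eq_0[OF k this[OF k]] show ?thesis
    by eventually_elim (simp add: k_def)
qed

section \<open>Optimality conditions\<close>

lemma admissible_convex:
  assumes u: "u \<in> admissible_controls M a b" and v: "v \<in> admissible_controls M a b"
    and t: "0 \<le> t" "t \<le> 1"
  shows "(\<lambda>x. u x + t * (v x - u x)) \<in> admissible_controls M a b"
proof -
  have conv: "a \<le> r + t * (s - r) \<and> r + t * (s - r) \<le> b"
    if "a \<le> r \<and> r \<le> b" "a \<le> s \<and> s \<le> b" for r s
  proof -
    have "r + t * (s - r) = (1 - t) * r + t * s" by (simp add: algebra_simps)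
    moreover have "(1 - t) * a + t * a \<le> (1 - t) * r + t * s"
      using that t by (intro add_mono mult_left_mono) auto
    moreover have "(1 - t) * r + t * s \<le> (1 - t) * b + t * b"
      using that t by (intro add_mono mult_left_mono) auto
    ultimately show ?thesis by (simp add: algebra_simps)
  qed
  have "AE x in M. a \<le> u x \<and> u x \<le> b" "AE x in M. a \<le> v x \<and> v x \<le> b"
    using u v by (simp_all add: admissible_controls_def)
  then have "AE x in M. a \<le> u x + t * (v x - u x) \<and> u x + t * (v x - u x) \<le> b"
    by eventually_elim (rule conv)
  with u v show ?thesis by (simp add: admissible_controls_def)
qed

lemma cost_cong_AE:
  assumes "y \<in> L2 M" "w \<in> borel_measurable M" "z \<in> L2 M" "AE x in M. w x = y x"
  shows "cost M \<alpha> z u w = cost M \<alpha> z u y"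
proof -
  have "(\<integral>x. (w x - z x)\<^sup>2 \<partial>M) = (\<integral>x. (y x - z x)\<^sup>2 \<partial>M)"
    using assms by (intro integral_cong_AE) (auto simp: L2_measurable)
  then show ?thesis by (simp add: cost_def L2_norm_def)
qed

lemma nonneg_of_small_perturbation:
  fixes A B :: real
  assumes "\<And>t. 0 < t \<Longrightarrow> t \<le> 1 \<Longrightarrow> 0 \<le> t * A + t\<^sup>2 * B"
  shows "0 \<le> A"
proof (rule tendsto_lowerbound)
  show "((\<lambda>t. A + t * B) \<longlongrightarrow> A) (at_right 0)"
    by (auto intro!: tendsto_eq_intros)
  have "0 \<le> A + t * B" if "t \<in> {0<..<1}" for t
    using assms[of t] that
    by (simp add: power2_eq_square mult.assoc distrib_left[symmetric] zero_le_mult_iff)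
  then show "\<forall>\<^sub>F t in at_right 0. 0 \<le> A + t * B"
    using eventually_at_right_real[of 0 1] by (auto elim: eventually_mono)
qed simp

text \<open>The cost is quadratic along the segment from \<open>u\<close> to any competitor \<open>v\<close>; its derivative at \<open>u\<close>
  is the inner product below, and it cannot be negative at a minimizer.\<close>

lemma control_variational_inequality:
  assumes opt: "solves_control_problem M Y S \<alpha> z a b u w"
    and S: "\<And>v. v \<in> L2 M \<Longrightarrow> S v \<in> L2 M" and Y: "\<And>v. v \<in> L2 M \<Longrightarrow> S v \<in> Y"
    and Y_L2: "Y \<subseteq> L2 M"
    and adj: "L2_adjoint M S S'" and z: "z \<in> L2 M"
    and v: "v \<in> admissible_controls M a b"
  shows "0 \<le> L2_inner M (\<lambda>x. \<alpha> * u x + S' (\<lambda>x. S u x - z x) x) (\<lambda>x. v x - u x)"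
proof -
  from opt have u: "u \<in> admissible_controls M a b" and w: "w \<in> Y" "AE x in M. w x = S u x"
    by (auto simp: solves_control_problem_def feasible_pairs_def)
  have uL: "u \<in> L2 M" and vL: "v \<in> L2 M" using u v by (auto simp: admissible_controls_def)
  define e where "e = (\<lambda>x. v x - u x)"
  define r where "r = (\<lambda>x. S u x - z x)"
  have eL: "e \<in> L2 M" and rL: "r \<in> L2 M" using uL vL z S by (simp_all add: e_def r_def)
  have adj': "S' r \<in> L2 M" "L2_inner M (S e) r = L2_inner M e (S' r)"
    using adj eL rL by (auto simp: L2_adjoint_def)
  define A where "A = L2_inner M r (S e) + \<alpha> * L2_inner M u e"
  define B where "B = (L2_inner M (S e) (S e) + \<alpha> * L2_inner M e e) / 2"
  have SeL: "S e \<in> L2 M" and SuL: "S u \<in> L2 M" using S eL uL by auto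
  have "0 \<le> t * A + t\<^sup>2 * B" if t: "0 < t" "t \<le> 1" for t
  proof -
    define c where "c = (\<lambda>x. u x + t * e x)"
    have c: "c \<in> admissible_controls M a b"
      using admissible_convex[OF u v, of t] t by (simp add: c_def e_def)
    then have cL: "c \<in> L2 M" by (simp add: admissible_controls_def)
    have "(c, S c) \<in> feasible_pairs M Y S a b"
      using c cL Y by (simp add: feasible_pairs_def)
    with opt have "cost M \<alpha> z u w \<le> cost M \<alpha> z c (S c)"
      by (auto simp: solves_control_problem_def)
    also have "cost M \<alpha> z u w = cost M \<alpha> z u (S u)"
      using w Y_L2 SuL z by (intro cost_cong_AE) (auto simp: L2_measurable)
    also have "cost M \<alpha> z c (S c) = cost M \<alpha> z c (\<lambda>x. S u x + t * S e x)"
      unfolding c_def using L2_adjoint_linear[OF S adj uL eL, of t] S uL eL z SuL SeL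
      by (intro cost_cong_AE) (simp_all add: L2_measurable)
    also have "\<dots> = 1 / 2 * (L2_norm M (\<lambda>x. r x + t * S e x))\<^sup>2 + \<alpha> / 2 * (L2_norm M c)\<^sup>2"
      by (simp add: cost_def r_def algebra_simps)
    also have "\<dots> = cost M \<alpha> z u (S u) + (t * A + t\<^sup>2 * B)"
      unfolding cost_def r_def[symmetric] L2_norm_power2 c_def A_def B_def
      using rL SeL uL eL
      by (simp add: L2_inner_bilinear L2_inner_commute[of M e u] L2_inner_commute[of M "S e" r]
          field_simps power2_eq_square)
    finally show ?thesis by simp
  qed
  then have "0 \<le> A" by (rule nonneg_of_small_perturbation)
  also have "A = L2_inner M (\<lambda>x. \<alpha> * u x + S' r x) e"
    using adj' uL eL rL SeL
    by (simp add: A_def L2_inner_bilinear L2_inner_commute[of M r "S e"] L2_inner_commute[of M e "S' r"])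
  finally show ?thesis by (simp add: r_def e_def)
qed

text \<open>The pointwise form depends on the measure only through its null sets and therefore survives
  the change of surface.  It follows by testing with the pointwise projection of \<open>u - q\<close> onto \<open>[a, b]\<close>: this moves
  \<open>u\<close> strictly against the sign of \<open>q\<close> wherever the constraints leave room, so that the integrand is
  nonpositive, and optimality forces it to vanish.  The distance of the test
  function to \<open>u\<close> is at most \<open>\<bar>q\<bar>\<close>, which keeps it in \<open>L\<^sup>2\<close>.\<close>

lemma variational_inequality_pointwise:
  assumes u: "u \<in> admissible_controls M a b" and q: "q \<in> L2 M"
    and vi: "\<And>v. v \<in> admissible_controls M a b \<Longrightarrow> 0 \<le> L2_inner M q (\<lambda>x. v x - u x)"
    and ab: "a \<le> b"
  shows "AE x in M. \<forall>c\<in>{a..b}. 0 \<le> q x * (c - u x)"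
proof -
  define v where "v = (\<lambda>x. max a (min b (u x - q x)))"
  have uL: "u \<in> L2 M" and ae: "AE x in M. a \<le> u x \<and> u x \<le> b"
    using u by (auto simp: admissible_controls_def)
  note [measurable] = L2_measurable[OF uL] L2_measurable[OF q]
  have eL: "(\<lambda>x. v x - u x) \<in> L2 M"
  proof (rule L2_dominated[OF q])
    show "AE x in M. \<bar>v x - u x\<bar> \<le> \<bar>q x\<bar>"
      using ae by eventually_elim (auto simp: v_def)
  qed (simp add: v_def)
  from L2_add[OF this uL] have "v \<in> L2 M" by simp
  then have "v \<in> admissible_controls M a b"
    using ab by (auto simp: admissible_controls_def v_def)
  from vi[OF this] have ge: "0 \<le> (\<integral>x. q x * (v x - u x) \<partial>M)"
    by (simp add: L2_inner_def)
  have sign: "AE x in M. q x * (v x - u x) \<le> 0"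
    using ae
  proof eventually_elim
    case (elim x)
    then show ?case by (cases "q x \<ge> 0") (auto simp: v_def mult_le_0_iff)
  qed
  have int: "integrable M (\<lambda>x. - (q x * (v x - u x)))"
    using L2_mult_integrable[OF q eL] by simp
  have "(\<integral>x. - (q x * (v x - u x)) \<partial>M) = 0"
  proof (rule antisym)
    show "0 \<le> (\<integral>x. - (q x * (v x - u x)) \<partial>M)"
      using sign by (intro integral_nonneg_AE) (auto elim: eventually_mono)
  qed (use ge in simp)
  then have "AE x in M. - (q x * (v x - u x)) = 0"
    using integral_nonneg_eq_0_iff_AE[OF int] sign by simp
  with ae show ?thesis
  proof eventually_elim
    case (elim x)
    have "u x = a" if "q x > 0"
      using elim that by (auto simp: v_def max_def min_def split: if_splits)
    moreover have "u x = b" if "q x < 0"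
      using elim that by (auto simp: v_def max_def min_def split: if_splits)
    ultimately show ?case
      by (cases "q x" "0 :: real" rule: linorder_cases) (auto simp: mult_nonpos_nonpos)
  qed
qed

text \<open>Adding the two variational inequalities bounds \<open>\<alpha>\<parallel>u\<^sub>h - u\<parallel>\<^sup>2\<close> by
  \<open>\<langle>p - T\<^sup>*(T u\<^sub>h - z), u\<^sub>h - u\<rangle>\<close>.  Inserting \<open>T\<^sup>*(y - z)\<close> splits this into a consistency error and
  \<open>- \<langle>T u\<^sub>h - y, T u\<^sub>h - T u\<rangle>\<close>, which contains \<open>- \<parallel>T u\<^sub>h - y\<parallel>\<^sup>2\<close>.  Young's inequality absorbs half of
  each of the two quadratic terms.\<close>

lemma control_error_estimate:
  assumes T: "\<And>v. v \<in> L2 M \<Longrightarrow> T v \<in> L2 M" and adj: "L2_adjoint M T T'" and \<alpha>: "\<alpha> > 0"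
    and L2: "u \<in> L2 M" "p \<in> L2 M" "y \<in> L2 M" "z \<in> L2 M" "uh \<in> L2 M"
    and vi: "0 \<le> L2_inner M (\<lambda>x. \<alpha> * u x + p x) (\<lambda>x. uh x - u x)"
    and vih: "0 \<le> L2_inner M (\<lambda>x. \<alpha> * uh x + T' (\<lambda>x. T uh x - z x) x) (\<lambda>x. u x - uh x)"
  shows "\<alpha> * (L2_norm M (\<lambda>x. uh x - u x))\<^sup>2 + (L2_norm M (\<lambda>x. T uh x - y x))\<^sup>2
    \<le> 1 / \<alpha> * (L2_norm M (\<lambda>x. T' (\<lambda>x. y x - z x) x - p x))\<^sup>2 + (L2_norm M (\<lambda>x. T u x - y x))\<^sup>2"
proof -
  define e where "e = (\<lambda>x. uh x - u x)"
  define rh where "rh = (\<lambda>x. T uh x - z x)"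
  define r where "r = (\<lambda>x. y x - z x)"
  define k where "k = (\<lambda>x. p x - T' r x)"
  define s where "s = (\<lambda>x. T uh x - y x)"
  define d where "d = (\<lambda>x. T u x - y x)"
  have mem: "T u \<in> L2 M" "T uh \<in> L2 M" "e \<in> L2 M" "rh \<in> L2 M" "r \<in> L2 M" "s \<in> L2 M" "d \<in> L2 M"
    using L2 T by (simp_all add: e_def rh_def r_def s_def d_def)
  have a: "T' w \<in> L2 M" "L2_inner M (T v) w = L2_inner M v (T' w)" if "v \<in> L2 M" "w \<in> L2 M" for v w
    using adj that by (auto simp: L2_adjoint_def)
  have mem': "T' rh \<in> L2 M" "T' r \<in> L2 M" using a(1) L2(1) mem by auto
  then have kL: "k \<in> L2 M" using L2 by (simp add: k_def)
  have dual: "L2_inner M (T' w) e = L2_inner M s w - L2_inner M d w" if w: "w \<in> L2 M" for w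
  proof -
    have "L2_inner M (T' w) e = L2_inner M (T uh) w - L2_inner M (T u) w"
      using L2 w a(1)[OF w w]
      by (simp add: e_def L2_inner_bilinear a(2) L2_inner_commute[of M "T' w"])
    also have "\<dots> = L2_inner M s w - L2_inner M d w"
      using L2 mem w by (simp add: s_def d_def L2_inner_bilinear)
    finally show ?thesis .
  qed
  have "L2_inner M (\<lambda>x. \<alpha> * uh x + T' rh x) (\<lambda>x. u x - uh x)
      = - L2_inner M (\<lambda>x. \<alpha> * uh x + T' rh x) e"
    using L2 mem mem' by (simp add: e_def L2_inner_bilinear right_diff_distrib)
  with vi vih
  have "L2_inner M (\<lambda>x. \<alpha> * uh x + T' rh x) e \<le> L2_inner M (\<lambda>x. \<alpha> * u x + p x) e"
    by (simp add: e_def rh_def)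
  moreover have "\<alpha> * L2_inner M e e = \<alpha> * L2_inner M uh e - \<alpha> * L2_inner M u e"
    unfolding e_def using L2 by (simp add: L2_inner_bilinear right_diff_distrib)
  ultimately have "\<alpha> * L2_inner M e e \<le> L2_inner M p e - L2_inner M (T' rh) e"
    using L2 mem mem' by (simp add: L2_inner_bilinear algebra_simps)
  also have "\<dots> = L2_inner M e k - (L2_inner M (T' rh) e - L2_inner M (T' r) e)"
    using L2 mem mem' by (simp add: k_def L2_inner_bilinear L2_inner_commute[of M e])
  also have "L2_inner M (T' rh) e - L2_inner M (T' r) e = L2_inner M s s - L2_inner M d s"
  proof -
    have "s = (\<lambda>x. rh x - r x)" by (auto simp: s_def rh_def r_def)
    then have "L2_inner M f s = L2_inner M f rh - L2_inner M f r" if "f \<in> L2 M" for f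
      using mem that by (simp add: L2_inner_bilinear)
    then show ?thesis using mem by (simp add: dual)
  qed
  finally have "\<alpha> * L2_inner M e e + L2_inner M s s \<le> L2_inner M e k + L2_inner M d s" by simp
  moreover have "2 * L2_inner M e k \<le> \<alpha> * L2_inner M e e + 1 / \<alpha> * L2_inner M k k"
    using L2_Young[OF mem(3) kL \<alpha>] .
  moreover have "2 * L2_inner M d s \<le> L2_inner M d d + L2_inner M s s"
    using L2_Young[OF mem(7,6), of 1] by simp
  ultimately have "\<alpha> * L2_inner M e e + L2_inner M s s \<le> 1 / \<alpha> * L2_inner M k k + L2_inner M d d"
    by linarith
  then show ?thesis
    using L2_norm_minus_commute[of M p "T' r"]
    unfolding L2_norm_power2[symmetric] e_def s_def d_def k_def r_def by simp
qed

section \<open>Finite element functions are weakly differentiable\<close>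

lemma segment_direction_in_tangent_space:
  assumes T: "convex T" and x: "x \<in> T" and y: "y \<in> T"
  shows "y - x \<in> tangent_space T x"
  unfolding tangent_space_def
proof (rule span_base, rule CollectI, intro exI conjI allI)
  fix k :: nat
  show "x + (1 / real (Suc k)) *\<^sub>R (y - x) \<in> T"
  proof -
    have "(1 - 1 / real (Suc k)) *\<^sub>R x + (1 / real (Suc k)) *\<^sub>R y \<in> T"
      using T x y by (intro convexD) auto
    then show ?thesis by (simp add: algebra_simps)
  qed
  show "0 < real (Suc k)" by simp
next
  have "(\<lambda>k. x + (1 / real (Suc k)) *\<^sub>R (y - x)) \<longlonglongrightarrow> x + 0 *\<^sub>R (y - x)"
    using LIMSEQ_inverse_real_of_nat by (intro tendsto_intros) (simp add: inverse_eq_divide)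
  then show "(\<lambda>k. x + (1 / real (Suc k)) *\<^sub>R (y - x)) \<longlonglongrightarrow> x" by simp
  show "(\<lambda>k. real (Suc k) *\<^sub>R (x + (1 / real (Suc k)) *\<^sub>R (y - x) - x)) \<longlonglongrightarrow> y - x"
    by (simp del: of_nat_Suc)
qed

text \<open>The slope \<open>g\<close> of an affine function is only determined up to vectors orthogonal to \<open>T\<close>; its
  orthogonal projection onto the span of the differences of points of \<open>T\<close> is a surface gradient at
  every point of \<open>T\<close> simultaneously.\<close>

lemma affine_on_has_surface_gradient:
  fixes \<phi> :: "'a::euclidean_space \<Rightarrow> real"
  assumes T: "convex T" and \<phi>: "affine_on T \<phi>"
  obtains g where "\<And>x. x \<in> T \<Longrightarrow> has_surface_gradient \<phi> g T x"
proof -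
  from \<phi> obtain c s where \<phi>: "\<And>x. x \<in> T \<Longrightarrow> \<phi> x = c + s \<bullet> x"
    by (auto simp: affine_on_def)
  define D where "D = {y' - y | y y'. y \<in> T \<and> y' \<in> T}"
  obtain g o' where g: "g \<in> span D" and o': "\<And>w. w \<in> span D \<Longrightarrow> o' \<bullet> w = 0" and s: "s = g + o'"
    using orthogonal_subspace_decomp_exists[of D s] unfolding real_inner_class.orthogonal_def by blast
  have "has_surface_gradient \<phi> g T x" if x: "x \<in> T" for x
    unfolding has_surface_gradient_def
  proof
    have "subspace (tangent_space T x)" by (simp add: tangent_space_def)
    have "D \<subseteq> tangent_space T x"
    proof
      fix w assume "w \<in> D"
      then obtain y y' where w: "y \<in> T" "y' \<in> T" "w = (y' - x) - (y - x)" by (auto simp: D_def)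
      then show "w \<in> tangent_space T x"
        unfolding w(3) using \<open>subspace _\<close> T x
        by (intro subspace_diff segment_direction_in_tangent_space)
    qed
    then have "span D \<subseteq> tangent_space T x" using \<open>subspace _\<close> by (rule span_minimal)
    with g show "g \<in> tangent_space T x" by blast
    have eq: "\<phi> x + g \<bullet> (y - x) = \<phi> y" if y: "y \<in> T" for y
    proof -
      have "y - x \<in> span D" using x y by (intro span_base) (auto simp: D_def)
      from o'[OF this] have "o' \<bullet> (y - x) = 0" .
      with x y show ?thesis by (simp add: \<phi> s inner_add_left inner_diff_right)
    qed
    have "((\<lambda>y. \<phi> x + g \<bullet> (y - x)) has_derivative (\<lambda>v. g \<bullet> v)) (at x within T)"
      by (auto intro!: derivative_eq_intros)
    then show "(\<phi> has_derivative (\<lambda>v. g \<bullet> v)) (at x within T)"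
      by (rule has_derivative_transform[OF x eq[symmetric], rotated])
  qed
  then show thesis by (rule that)
qed

text \<open>A finite element function is piecewise \<open>C\<^sup>1\<close> itself, so a constant sequence approximates it.\<close>

lemma FE_pairs_subset_H1_pairs:
  assumes conv: "\<And>T. T \<in> \<T> \<Longrightarrow> convex T"
  shows "FE_pairs n \<T> \<subseteq> H1_pairs n \<T>"
proof (rule subrelI)
  fix \<phi> :: "'a \<Rightarrow> real" and G assume "(\<phi>, G) \<in> FE_pairs n \<T>"
  then have cl: "(\<phi>, G) \<in> classical_pairs n (\<Union>\<T>)" and FE: "\<phi> \<in> FE_space \<T>"
    by (auto simp: FE_pairs_def)
  have "piecewise_C1 \<T> \<phi>"
    unfolding piecewise_C1_def
  proof (intro conjI ballI)
    show "continuous_on (\<Union>\<T>) \<phi>" using FE by (simp add: FE_space_def)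
    fix T assume T: "T \<in> \<T>"
    then have "affine_on T \<phi>" using FE by (simp add: FE_space_def)
    from affine_on_has_surface_gradient[OF conv[OF T] this]
    obtain g where "\<And>x. x \<in> T \<Longrightarrow> has_surface_gradient \<phi> g T x" by blast
    then show "\<exists>G. continuous_on T G \<and> (\<forall>x\<in>T. has_surface_gradient \<phi> (G x) T x)"
      by (intro exI[of _ "\<lambda>_. g"]) auto
  qed
  with cl show "(\<phi>, G) \<in> H1_pairs n \<T>"
    unfolding H1_pairs_def Let_def
    by (auto simp: classical_pairs_def L2_norm_def intro!: exI[of _ "\<lambda>_. \<phi>"] exI[of _ "\<lambda>_. G"])
qed

lemma H1_subset_L2: "H1 n \<P> \<subseteq> L2 (surface_measure n (\<Union>\<P>))"
  by (auto simp: H1_def H1_pairs_def Let_def)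

lemma solution_operator_in_H1:
  assumes "solution_operator M V S" "V \<subseteq> H1_pairs n \<P>" "v \<in> L2 M"
  shows "S v \<in> H1 n \<P>"
  using assms by (force simp: solution_operator_def variational_solution_def H1_def)

section \<open>The error estimate\<close>

lemma space_surface_measure: "space (surface_measure n \<Sigma>) = \<Sigma>"
  by (simp add: surface_measure_def space_restrict_space space_measure_of_conv)

theorem theorem2p2:
  fixes n :: nat
    and \<Gamma> N :: "'a::euclidean_space set"
    and \<nu> :: "'a \<Rightarrow> 'a"
    and d :: "'a \<Rightarrow> real"
    and H :: "real set"
    and \<T> :: "real \<Rightarrow> 'a set set"
    and S S_adj :: "('a \<Rightarrow> real) \<Rightarrow> 'a \<Rightarrow> real"
    and Sh Sh_adj :: "real \<Rightarrow> ('a \<Rightarrow> real) \<Rightarrow> 'a \<Rightarrow> real"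
    and c_int \<alpha> a b :: real
    and z u :: "'a \<Rightarrow> real"
  defines "M \<equiv> surface_measure n \<Gamma>"
    and "Mh \<equiv> \<lambda>h. surface_measure n (\<Union>(\<T> h))"
    and "lft \<equiv> \<lambda>h. lift (projection d) (\<Union>(\<T> h))"
    and "unlft \<equiv> inverse_lift (projection d)"
    and "y \<equiv> S u"
  assumes dim: "n \<in> {1, 2}" "DIM('a) = n + 1"
    and surface: "compact \<Gamma>" "C2_hypersurface \<Gamma>" "unit_normal_field \<Gamma> \<nu>"
    and distance: "signed_distance \<Gamma> \<nu> d" "projection_nbhd \<Gamma> d N"
    and discrete: "discrete_surfaces n \<Gamma> d N H \<T>"
    and c_int: "interpolation_constant n \<Gamma> d H \<T> c_int"
    and S: "solution_operator M (H1_pairs n {\<Gamma>}) S" "L2_adjoint M S S_adj"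
    and Sh: "\<And>h. h \<in> H \<Longrightarrow> solution_operator (Mh h) (FE_pairs n (\<T> h)) (Sh h)"
            "\<And>h. h \<in> H \<Longrightarrow> L2_adjoint (Mh h) (Sh h) (Sh_adj h)"
    and data: "\<alpha> > 0" "z \<in> L2 M" "a < b"
    and P: "\<exists>w. solves_control_problem M (H1 n {\<Gamma>}) S \<alpha> z a b u w"
  shows "\<forall>\<^sub>F h in at 0 within H. \<forall>uh.
    (\<exists>w. solves_control_problem (Mh h) (H1 n (\<T> h)) (Sh h) \<alpha> (unlft z) a b uh w) \<longrightarrow>
      \<alpha> * (L2_norm M (\<lambda>x. lft h uh x - u x))\<^sup>2 + (L2_norm M (\<lambda>x. lft h (Sh h uh) x - y x))\<^sup>2
      \<le> (1 + c_int * h\<^sup>2) / (1 - c_int * h\<^sup>2) *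
        (1 / \<alpha> * (L2_norm M (\<lambda>x. lft h (Sh_adj h (unlft (\<lambda>x. y x - z x))) x
                                 - S_adj (\<lambda>x. y x - z x) x))\<^sup>2
         + (L2_norm M (\<lambda>x. lft h (Sh h (unlft u)) x - S u x))\<^sup>2)"
proof -
  define p where "p = projection d"
  have yL: "y \<in> L2 M"
    and SL: "\<And>v. v \<in> L2 M \<Longrightarrow> S v \<in> L2 M" and SY: "\<And>v. v \<in> L2 M \<Longrightarrow> S v \<in> H1 n {\<Gamma>}"
    and uA: "u \<in> admissible_controls M a b"
  proof -
    show uA: "u \<in> admissible_controls M a b"
      using P by (auto simp: solves_control_problem_def feasible_pairs_def)
    show Y: "S v \<in> H1 n {\<Gamma>}" if "v \<in> L2 M" for v
      using solution_operator_in_H1[OF S(1) order_refl that] .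
    show SL: "S v \<in> L2 M" if "v \<in> L2 M" for v
      using Y[OF that] H1_subset_L2[of n "{\<Gamma>}"] by (auto simp: M_def)
    show "y \<in> L2 M" using uA SL by (simp add: y_def admissible_controls_def)
  qed
  have uL: "u \<in> L2 M" using uA by (simp add: admissible_controls_def)
  define padj where "padj = S_adj (\<lambda>x. y x - z x)"
  have padjL: "padj \<in> L2 M"
    using S(2) yL data(2) by (simp add: padj_def L2_adjoint_def)
  have "0 \<le> L2_inner M (\<lambda>x. \<alpha> * u x + padj x) (\<lambda>x. v x - u x)"
    if "v \<in> admissible_controls M a b" for v
  proof -
    from P obtain w where w: "solves_control_problem M (H1 n {\<Gamma>}) S \<alpha> z a b u w" ..
    have "H1 n {\<Gamma>} \<subseteq> L2 M" using H1_subset_L2[of n "{\<Gamma>}"] by (simp add: M_def)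
    from control_variational_inequality[OF w SL SY this S(2) data(2) that]
    show ?thesis by (simp add: padj_def y_def)
  qed
  then have pointwise: "AE x in M. \<forall>c\<in>{a..b}. 0 \<le> (\<alpha> * u x + padj x) * (c - u x)"
    using uA uL padjL data(3) by (intro variational_inequality_pointwise) simp_all
  have ev_H: "\<forall>\<^sub>F h in at 0 within H. h \<in> H"
    by (simp add: eventually_at_filter)
  have ev_inj: "\<forall>\<^sub>F h in at 0 within H. inj_on p (\<Union>(\<T> h))"
    using discrete by (simp add: discrete_surfaces_def p_def)
  have ev_norm: "\<forall>\<^sub>F h in at 0 within H.
      (L2_opnorm M (Mh h) unlft)\<^sup>2 \<le> ereal (1 + c_int * h\<^sup>2) \<and>
      (L2_opnorm (Mh h) M (lft h))\<^sup>2 \<le> ereal (1 + c_int * h\<^sup>2)"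
    using c_int unfolding interpolation_constant_def Let_def M_def Mh_def lft_def unlft_def
    by (auto elim: eventually_mono)
  have ev_small: "\<forall>\<^sub>F h in at 0 within H. c_int * h\<^sup>2 < 1"
  proof -
    have "((\<lambda>h. c_int * h\<^sup>2) \<longlongrightarrow> 0) (at 0 within H)"
      by (auto intro!: tendsto_eq_intros)
    then show ?thesis by (rule order_tendstoD) simp
  qed
  show ?thesis
    using ev_H ev_inj ev_norm ev_small
  proof (eventually_elim, intro allI impI)
    fix h uh
    assume h: "h \<in> H" and inj: "inj_on p (\<Union>(\<T> h))"
      and norms: "(L2_opnorm M (Mh h) unlft)\<^sup>2 \<le> ereal (1 + c_int * h\<^sup>2) \<and>
        (L2_opnorm (Mh h) M (lft h))\<^sup>2 \<le> ereal (1 + c_int * h\<^sup>2)"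
      and small: "c_int * h\<^sup>2 < 1"
      and "\<exists>w. solves_control_problem (Mh h) (H1 n (\<T> h)) (Sh h) \<alpha> (unlft z) a b uh w"
    then obtain w
      where w: "solves_control_problem (Mh h) (H1 n (\<T> h)) (Sh h) \<alpha> (unlft z) a b uh w" by blast
    define C where "C = 1 + c_int * h\<^sup>2"
    have image: "p ` \<Union>(\<T> h) = \<Gamma>"
      using discrete h by (simp add: discrete_surfaces_def p_def)
    have space: "space M = \<Gamma>" "space (Mh h) = \<Union>(\<T> h)"
      by (simp_all add: M_def Mh_def space_surface_measure)
    have unlft: "unlft f \<in> L2 (Mh h)" "(L2_norm (Mh h) (unlft f))\<^sup>2 \<le> C * (L2_norm M f)\<^sup>2"
      if "f \<in> L2 M" for f
      unfolding C_def
      using L2_opnorm_bound[OF conjunct1[OF norms] _ that]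
      by (simp_all add: unlft_def inverse_lift_def fun_eq_iff)
    have lft: "lft h f \<in> L2 M" "(L2_norm M (lft h f))\<^sup>2 \<le> C * (L2_norm (Mh h) f)\<^sup>2"
      if "f \<in> L2 (Mh h)" for f
      unfolding C_def
      using L2_opnorm_bound[OF conjunct2[OF norms] _ that]
      by (simp_all add: lft_def lift_def fun_eq_iff)
    have lft_unlft: "lft h (unlft f) x = f x" if "x \<in> \<Gamma>" for f x
      using that image by (simp add: lft_def unlft_def lift_def inverse_lift_def p_def f_inv_into_f)
    have unlft_lft: "unlft (lft h f) x = f x" if "x \<in> \<Union>(\<T> h)" for f x
      using that inj
      by (simp add: lft_def unlft_def lift_def inverse_lift_def p_def inv_into_f_f del: UN_iff Union_iff)
    have transfer: "AE x in Mh h. Q (p x)" if "AE x in M. Q x" for Q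
    proof (rule AE_inverse_lift[OF _ _ _ that])
      show "\<And>x. x \<in> space (Mh h) \<Longrightarrow> p x \<in> space M" using image space by blast
    qed (use unlft in \<open>auto simp: unlft_def p_def\<close>)

    have "convex T" if "T \<in> \<T> h" for T
      using discrete h that convex_simplex
      by (fastforce simp: discrete_surfaces_def inscribed_polyhedral_surface_def)
    then have ShY: "Sh h v \<in> H1 n (\<T> h)" if "v \<in> L2 (Mh h)" for v
      using solution_operator_in_H1[OF Sh(1)[OF h] FE_pairs_subset_H1_pairs that] by blast
    have YL: "H1 n (\<T> h) \<subseteq> L2 (Mh h)" by (simp add: Mh_def H1_subset_L2)
    have ShL: "Sh h v \<in> L2 (Mh h)" if "v \<in> L2 (Mh h)" for v using ShY[OF that] YL by blast
    have uhA: "uh \<in> admissible_controls (Mh h) a b"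
      using w by (simp add: solves_control_problem_def feasible_pairs_def)
    then have uhL: "uh \<in> L2 (Mh h)" and uh_ae: "AE x in Mh h. a \<le> uh x \<and> uh x \<le> b"
      by (auto simp: admissible_controls_def)
    have ulA: "unlft u \<in> admissible_controls (Mh h) a b"
      using transfer[of "\<lambda>x. a \<le> u x \<and> u x \<le> b"] uA unlft(1)[OF uL]
      by (simp add: admissible_controls_def unlft_def inverse_lift_def p_def)

    have vih: "0 \<le> L2_inner (Mh h) (\<lambda>x. \<alpha> * uh x + Sh_adj h (\<lambda>x. Sh h uh x - unlft z x) x)
        (\<lambda>x. unlft u x - uh x)"
      by (rule control_variational_inequality[OF w ShL ShY YL Sh(2)[OF h] unlft(1)[OF data(2)] ulA])
    \<comment> \<open>The continuous condition holds pointwise, hence also with respect to the measure of the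
      discrete surface.\<close>
    have vi: "0 \<le> L2_inner (Mh h) (\<lambda>x. \<alpha> * unlft u x + unlft padj x) (\<lambda>x. uh x - unlft u x)"
      unfolding L2_inner_def
    proof (rule integral_nonneg_AE)
      show "AE x in Mh h. 0 \<le> (\<alpha> * unlft u x + unlft padj x) * (uh x - unlft u x)"
        using transfer[OF pointwise] uh_ae
        by eventually_elim (simp add: unlft_def inverse_lift_def p_def)
    qed

    define E where "E = 1 / \<alpha> * (L2_norm (Mh h) (\<lambda>x. Sh_adj h (unlft (\<lambda>x. y x - z x)) x - unlft padj x))\<^sup>2
        + (L2_norm (Mh h) (\<lambda>x. Sh h (unlft u) x - unlft y x))\<^sup>2"
    have discrete_estimate:
      "\<alpha> * (L2_norm (Mh h) (\<lambda>x. uh x - unlft u x))\<^sup>2 + (L2_norm (Mh h) (\<lambda>x. Sh h uh x - unlft y x))\<^sup>2 \<le> E"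
    proof -
      have "unlft (\<lambda>x. y x - z x) = (\<lambda>x. unlft y x - unlft z x)"
        by (simp add: unlft_def inverse_lift_def fun_eq_iff)
      then show ?thesis
        unfolding E_def
        using control_error_estimate[OF ShL Sh(2)[OF h] data(1) unlft(1)[OF uL] unlft(1)[OF padjL]
            unlft(1)[OF yL] unlft(1)[OF data(2)] uhL vi vih]
        by simp
    qed

    have lift_error: "(L2_norm M (\<lambda>x. lft h f x - g x))\<^sup>2 \<le> C * (L2_norm (Mh h) (\<lambda>x. f x - unlft g x))\<^sup>2"
      if f: "f \<in> L2 (Mh h)" and g: "g \<in> L2 M" for f g
    proof -
      have "lft h (\<lambda>x. f x - unlft g x) x = lft h f x - g x" if "x \<in> space M" for x
        using lft_unlft[of x g] that space by (simp add: lft_def lift_def)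
      then have "L2_norm M (\<lambda>x. lft h f x - g x) = L2_norm M (lft h (\<lambda>x. f x - unlft g x))"
        by (intro L2_norm_cong) simp
      with lft(2)[of "\<lambda>x. f x - unlft g x"] f unlft(1)[OF g] show ?thesis by simp
    qed
    have inverse_lift_error:
      "(L2_norm (Mh h) (\<lambda>x. f x - unlft g x))\<^sup>2 \<le> C * (L2_norm M (\<lambda>x. lft h f x - g x))\<^sup>2"
      if f: "f \<in> L2 (Mh h)" and g: "g \<in> L2 M" for f g
    proof -
      have "unlft (\<lambda>x. lft h f x - g x) x = f x - unlft g x" if "x \<in> space (Mh h)" for x
        using unlft_lft[of x f] that space by (simp add: unlft_def inverse_lift_def)
      then have "L2_norm (Mh h) (\<lambda>x. f x - unlft g x) = L2_norm (Mh h) (unlft (\<lambda>x. lft h f x - g x))"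
        by (intro L2_norm_cong) simp
      with unlft(2)[of "\<lambda>x. lft h f x - g x"] lft(1)[OF f] g show ?thesis by simp
    qed

    have ulL: "unlft u \<in> L2 (Mh h)" using unlft(1)[OF uL] .
    have adjL: "Sh_adj h (unlft (\<lambda>x. y x - z x)) \<in> L2 (Mh h)"
      using Sh(2)[OF h] unlft(1)[of "\<lambda>x. y x - z x"] yL data(2) by (simp add: L2_adjoint_def)
    have "c_int > 0" using c_int by (simp add: interpolation_constant_def)
    then have C0: "C \<ge> 0" by (simp add: C_def)
    define F where "F = 1 / \<alpha> * (L2_norm M (\<lambda>x. lft h (Sh_adj h (unlft (\<lambda>x. y x - z x))) x
                                 - S_adj (\<lambda>x. y x - z x) x))\<^sup>2
         + (L2_norm M (\<lambda>x. lft h (Sh h (unlft u)) x - S u x))\<^sup>2"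
    have "\<alpha> * (L2_norm M (\<lambda>x. lft h uh x - u x))\<^sup>2 + (L2_norm M (\<lambda>x. lft h (Sh h uh) x - y x))\<^sup>2
      \<le> \<alpha> * (C * (L2_norm (Mh h) (\<lambda>x. uh x - unlft u x))\<^sup>2)
        + C * (L2_norm (Mh h) (\<lambda>x. Sh h uh x - unlft y x))\<^sup>2"
      using data(1) uhL uL yL ShL by (intro add_mono mult_left_mono lift_error) simp_all
    also have "\<dots> = C * (\<alpha> * (L2_norm (Mh h) (\<lambda>x. uh x - unlft u x))\<^sup>2
        + (L2_norm (Mh h) (\<lambda>x. Sh h uh x - unlft y x))\<^sup>2)"
      by (simp add: algebra_simps)
    also have "\<dots> \<le> C * E"
      using discrete_estimate C0 by (rule mult_left_mono)
    also have "E \<le> 1 / \<alpha> * (C * (L2_norm M (\<lambda>x. lft h (Sh_adj h (unlft (\<lambda>x. y x - z x))) x - padj x))\<^sup>2)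
        + C * (L2_norm M (\<lambda>x. lft h (Sh h (unlft u)) x - y x))\<^sup>2"
      unfolding E_def using data(1) adjL padjL ulL yL ShL
      by (intro add_mono mult_left_mono inverse_lift_error) simp_all
    also have "\<dots> = C * F"
      by (simp add: F_def padj_def y_def algebra_simps)
    finally have "\<alpha> * (L2_norm M (\<lambda>x. lft h uh x - u x))\<^sup>2 + (L2_norm M (\<lambda>x. lft h (Sh h uh) x - y x))\<^sup>2
      \<le> (C * C) * F"
      using C0 by (simp add: mult_left_mono mult.assoc)
    also have "C * C \<le> (1 + c_int * h\<^sup>2) / (1 - c_int * h\<^sup>2)"
    proof -
      have "C * (1 - c_int * h\<^sup>2) \<le> 1"
        using \<open>c_int > 0\<close> by (simp add: C_def algebra_simps)
      then have "C * (C * (1 - c_int * h\<^sup>2)) \<le> C * 1" using C0 by (rule mult_left_mono)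
      then show ?thesis using small by (simp add: C_def pos_le_divide_eq mult.assoc)
    qed
    finally show "\<alpha> * (L2_norm M (\<lambda>x. lft h uh x - u x))\<^sup>2 + (L2_norm M (\<lambda>x. lft h (Sh h uh) x - y x))\<^sup>2
      \<le> (1 + c_int * h\<^sup>2) / (1 - c_int * h\<^sup>2) *
        (1 / \<alpha> * (L2_norm M (\<lambda>x. lft h (Sh_adj h (unlft (\<lambda>x. y x - z x))) x
                                 - S_adj (\<lambda>x. y x - z x) x))\<^sup>2
         + (L2_norm M (\<lambda>x. lft h (Sh h (unlft u)) x - S u x))\<^sup>2)"
      using data(1) by (simp add: F_def mult_right_mono)
  qed
qed

end
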